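(* Let $R$ be a finite commutative ring with identity and $P$ a proper prime ideal of $R$ with $|P|\geq 2$. The edge ideal $I=I(\Gamma_P(R))\subseteq S=k[x_1,\ldots,x_a,y_1,\ldots,y_b]$ of the prime ideal graph is matroidal. In particular, $I$ is polymatroidal.
   Context: The prime ideal graph $\Gamma_P(R)$ is the simple graph with vertex set $R\setminus\{0\}$ in which two distinct vertices $x,y$ are adjacent if and only if $xy\in P$. Put $a=|P|-1$ and $b=|P|(|R/P|-1)=|R\setminus P|$. Write $P\setminus\{0\}=\{u_1,\ldots,u_a\}$, $R\setminus P=\{v_1,\ldots,v_b\}$; attach the variable $x_i$ to $u_i$ and $y_\ell$ to $v_\ell$. Let $k$ be a field and $S=k[x_1,\ldots,x_a,y_1,\ldots,y_b]$. The edge ideal $I=I(\Gamma_P(R))$ is the ideal of $S$ generated by the products of the two variables attached to the endpoints of each edge; explicitly $I=(x_ix_j,\;x_iy_\ell \mid 1\leq i<j\leq a,\;1\leq i\leq a,\;1\leq \ell\leq b)$. $G(L)$ denotes the set of minimal monomial generators of a monomial ideal $L$. A monomial ideal $L\subseteq k[z_1,\ldots,z_r]$ generated in a single degree is polymatroidal if for any two monomials $u=z_1^{\alpha_1}\cdots z_r^{\alpha_r}$, $v=z_1^{\beta_1}\cdots z_r^{\beta_r}$ in $G(L)$ and any $i$ with $\alpha_i>\beta_i$, there exists $j$ with $\alpha_j<\beta_j$ and $z_ju/z_i\in G(L)$. A square-free monomial ideal generated in one degree is matroidal if the supports of its minimal generators are the bases of a matroid on the set of variables. *)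

theory Defs
  imports
    "HOL-Algebra.QuotRing"
    "HOL-Library.Poly_Mapping"
    "Graph_Theory.Pair_Digraph"
begin

section \<open>The prime ideal graph\<close>

text \<open>
  A simple graph is a \<^locale>\<open>pair_graph\<close>: an edge between \<open>x\<close> and \<open>y\<close> is
  represented by the two opposite arcs \<open>(x, y)\<close> and \<open>(y, x)\<close>.
\<close>

definition prime_ideal_graph :: "('a, 'm) ring_scheme \<Rightarrow> 'a set \<Rightarrow> 'a pair_pre_digraph" where
  "prime_ideal_graph R P =
    \<lparr> pverts = carrier R - {\<zero>\<^bsub>R\<^esub>},
      parcs = {(x, y). x \<in> carrier R - {\<zero>\<^bsub>R\<^esub>} \<and> y \<in> carrier R - {\<zero>\<^bsub>R\<^esub>} \<and>
                       x \<noteq> y \<and> x \<otimes>\<^bsub>R\<^esub> y \<in> P} \<rparr>"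

lemma pair_graph_prime_ideal_graph:
  assumes "cring R" and "finite (carrier R)"
  shows "pair_graph (prime_ideal_graph R P)"
proof -
  interpret cring R by fact
  have "parcs (prime_ideal_graph R P) \<subseteq> carrier R \<times> carrier R"
    by (auto simp: prime_ideal_graph_def)
  then have "finite (parcs (prime_ideal_graph R P))"
    using assms(2) finite_subset by blast
  then show ?thesis
    using assms(2)
    by unfold_locales
      (auto simp: prime_ideal_graph_def symmetric_def sym_def arcs_ends_def arc_to_ends_def m_comm)
qed


section \<open>Polynomial rings over a set of variables\<close>

text \<open>
  A monomial is identified with its exponent vector, a finitely supported function of type
  \<open>'v \<Rightarrow>\<^sub>0 nat\<close>; its support is \<^const>\<open>Poly_Mapping.keys\<close>, and product and quotient of
  monomials are the pointwise sum and difference of exponent vectors. A polynomial is a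
  finitely supported function from monomials to coefficients.
\<close>

definition monomials :: "'v set \<Rightarrow> ('v \<Rightarrow>\<^sub>0 nat) set" where
  "monomials V = {u. Poly_Mapping.keys u \<subseteq> V}"

definition mono_deg :: "('v \<Rightarrow>\<^sub>0 nat) \<Rightarrow> nat" where
  "mono_deg u = (\<Sum>z\<in>Poly_Mapping.keys u. Poly_Mapping.lookup u z)"

definition mono_poly :: "('v \<Rightarrow>\<^sub>0 nat) \<Rightarrow> ('v \<Rightarrow>\<^sub>0 nat) \<Rightarrow>\<^sub>0 'k::comm_ring_1" where
  "mono_poly u = Poly_Mapping.single u 1"

abbreviation var_exp :: "'v \<Rightarrow> ('v \<Rightarrow>\<^sub>0 nat)" where
  "var_exp z \<equiv> Poly_Mapping.single z 1"

definition var_poly :: "'v \<Rightarrow> ('v \<Rightarrow>\<^sub>0 nat) \<Rightarrow>\<^sub>0 'k::comm_ring_1" where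
  "var_poly z = mono_poly (var_exp z)"

definition poly_ring :: "'v set \<Rightarrow> (('v \<Rightarrow>\<^sub>0 nat) \<Rightarrow>\<^sub>0 'k::comm_ring_1) ring" where
  "poly_ring V =
    \<lparr> carrier = {p. Poly_Mapping.keys p \<subseteq> monomials V},
      monoid.mult = (*), one = 1, ring.zero = 0, add = (+) \<rparr>"

lemma cring_poly_ring: "cring (poly_ring V :: (('v \<Rightarrow>\<^sub>0 nat) \<Rightarrow>\<^sub>0 'k::comm_ring_1) ring)"
proof (rule cringI)
  let ?S = "poly_ring V :: (('v \<Rightarrow>\<^sub>0 nat) \<Rightarrow>\<^sub>0 'k) ring"
  have add: "p + q \<in> carrier ?S" if "p \<in> carrier ?S" "q \<in> carrier ?S" for p q
    using that keys_add[of p q] by (auto simp: poly_ring_def)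
  have mult: "p * q \<in> carrier ?S" if "p \<in> carrier ?S" "q \<in> carrier ?S" for p q
  proof -
    have "u + v \<in> monomials V" if "u \<in> monomials V" "v \<in> monomials V" for u v :: "'v \<Rightarrow>\<^sub>0 nat"
      using that keys_add[of u v] by (auto simp: monomials_def)
    then show ?thesis
      using that keys_mult[of p q] by (fastforce simp: poly_ring_def)
  qed
  show "abelian_group ?S"
  proof (rule abelian_groupI)
    show "\<exists>q\<in>carrier ?S. q \<oplus>\<^bsub>?S\<^esub> p = \<zero>\<^bsub>?S\<^esub>" if "p \<in> carrier ?S" for p
      using that by (intro bexI[of _ "- p"]) (auto simp: poly_ring_def)
  qed (use add in \<open>auto simp: poly_ring_def add_ac\<close>)
  show "comm_monoid ?S"
    by (rule comm_monoidI) (use mult in \<open>auto simp: poly_ring_def monomials_def mult_ac\<close>)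
qed (auto simp: poly_ring_def distrib_right)

definition edge_ideal :: "'v pair_pre_digraph \<Rightarrow> (('v \<Rightarrow>\<^sub>0 nat) \<Rightarrow>\<^sub>0 'k::comm_ring_1) set" where
  "edge_ideal G =
    genideal (poly_ring (pverts G)) {var_poly x * var_poly y | x y. (x, y) \<in> parcs G}"


section \<open>Monomial ideals\<close>

definition generates ::
    "'v set \<Rightarrow> ('v \<Rightarrow>\<^sub>0 nat) set \<Rightarrow> (('v \<Rightarrow>\<^sub>0 nat) \<Rightarrow>\<^sub>0 'k::comm_ring_1) set \<Rightarrow> bool" where
  "generates V M L \<longleftrightarrow> M \<subseteq> monomials V \<and> L = genideal (poly_ring V) (mono_poly ` M)"

definition monomial_ideal :: "'v set \<Rightarrow> (('v \<Rightarrow>\<^sub>0 nat) \<Rightarrow>\<^sub>0 'k::comm_ring_1) set \<Rightarrow> bool" where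
  "monomial_ideal V L \<longleftrightarrow> (\<exists>M. generates V M L)"

text \<open>
  The set \<open>G(L)\<close> is the inclusion-minimal set of monomials generating \<open>L\<close>; a monomial ideal has
  exactly one such set. For ideals that are not monomial the value is unspecified.
\<close>

definition min_gens ::
    "'v set \<Rightarrow> (('v \<Rightarrow>\<^sub>0 nat) \<Rightarrow>\<^sub>0 'k::comm_ring_1) set \<Rightarrow> ('v \<Rightarrow>\<^sub>0 nat) set" where
  "min_gens V L = (THE M. generates V M L \<and> (\<forall>N. N \<subset> M \<longrightarrow> \<not> generates V N L))"

definition generated_in_single_degree ::
    "'v set \<Rightarrow> (('v \<Rightarrow>\<^sub>0 nat) \<Rightarrow>\<^sub>0 'k::comm_ring_1) set \<Rightarrow> bool" where
  "generated_in_single_degree V L \<longleftrightarrow> (\<exists>d. \<forall>u\<in>min_gens V L. mono_deg u = d)"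

definition squarefree_ideal :: "'v set \<Rightarrow> (('v \<Rightarrow>\<^sub>0 nat) \<Rightarrow>\<^sub>0 'k::comm_ring_1) set \<Rightarrow> bool" where
  "squarefree_ideal V L \<longleftrightarrow> (\<forall>u\<in>min_gens V L. \<forall>z. Poly_Mapping.lookup u z \<le> 1)"

definition polymatroidal :: "'v set \<Rightarrow> (('v \<Rightarrow>\<^sub>0 nat) \<Rightarrow>\<^sub>0 'k::comm_ring_1) set \<Rightarrow> bool" where
  "polymatroidal V L \<longleftrightarrow>
    monomial_ideal V L \<and> generated_in_single_degree V L \<and>
    (\<forall>u\<in>min_gens V L. \<forall>v\<in>min_gens V L. \<forall>i\<in>V. Poly_Mapping.lookup u i > Poly_Mapping.lookup v i \<longrightarrow>
      (\<exists>j\<in>V. Poly_Mapping.lookup u j < Poly_Mapping.lookup v j \<and> var_exp j + u - var_exp i \<in> min_gens V L))"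


section \<open>Matroidal ideals\<close>

locale matroid =
  fixes E :: "'v set" and indep :: "'v set \<Rightarrow> bool"
  assumes finite_ground: "finite E"
    and indep_subset_ground: "indep X \<Longrightarrow> X \<subseteq> E"
    and indep_empty: "indep {}"
    and indep_subset: "indep X \<Longrightarrow> Y \<subseteq> X \<Longrightarrow> indep Y"
    and augment: "indep X \<Longrightarrow> indep Y \<Longrightarrow> card X < card Y \<Longrightarrow> \<exists>y\<in>Y - X. indep (insert y X)"

definition bases :: "('v set \<Rightarrow> bool) \<Rightarrow> 'v set set" where
  "bases indep = {B. indep B \<and> (\<forall>X. indep X \<longrightarrow> B \<subseteq> X \<longrightarrow> X = B)}"

definition matroidal :: "'v set \<Rightarrow> (('v \<Rightarrow>\<^sub>0 nat) \<Rightarrow>\<^sub>0 'k::comm_ring_1) set \<Rightarrow> bool" where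
  "matroidal V L \<longleftrightarrow>
    monomial_ideal V L \<and> squarefree_ideal V L \<and> generated_in_single_degree V L \<and>
    (\<exists>indep. matroid V indep \<and> Poly_Mapping.keys ` min_gens V L = bases indep)"

end

theory Submission
  imports Defs
begin

text \<open>
  Since \<open>P\<close> is prime, two distinct non-zero elements are adjacent exactly when at least one of
  them lies in \<open>P\<close>. The edges are therefore the two-element subsets of \<open>V = R - {0}\<close> that are not
  contained in \<open>V - P\<close>. These are the bases of a matroid on \<open>V\<close>: take as independent the
  sets with at most two elements of which at most one lies outside \<open>P\<close>, that is, truncate to rank two
  the direct sum of the free matroid on \<open>P - {0}\<close> and the rank-one uniform matroid on \<open>V - P\<close>
  (\<open>matroid_at_most_one_outside\<close>). The rank really is two, because \<open>V\<close> contains both a non-zero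
  element of \<open>P\<close> and \<open>1\<close>, which lies outside \<open>P\<close>.

  It remains to pass from edges to the set \<open>G(I)\<close>. A monomial lies in a monomial ideal exactly if
  a generator divides it (\<open>mono_poly_in_genideal_iff\<close>), so a generating set of monomials without
  proper divisibilities is contained in every other one and is the minimal one. The monomials of
  the edges all have degree two, hence they are \<open>G(I)\<close> (\<open>min_gens_edge_ideal\<close>).

  Finally, every matroidal ideal is polymatroidal (\<open>matroidal_imp_polymatroidal\<close>), because
  for square-free monomials the exchange condition on exponents is the exchange property of the
  bases of a matroid.
\<close>

section \<open>Minimal generators of monomial ideals\<close>

lemma monomials_add_iff: "u + w \<in> monomials V \<longleftrightarrow> u \<in> monomials V \<and> w \<in> monomials V"
proof -
  have "Poly_Mapping.keys (u + w) = Poly_Mapping.keys u \<union> Poly_Mapping.keys w"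
    by (auto simp: in_keys_iff lookup_add)
  then show ?thesis
    by (auto simp: monomials_def)
qed

text \<open>
  This ideal contains the monomials in \<open>M\<close>, hence also the ideal that they generate. It bounds the
  latter from above without any computation with linear combinations of generators.
\<close>

lemma ideal_multiples:
  "ideal {p \<in> carrier (poly_ring V). \<forall>u\<in>Poly_Mapping.keys p. \<exists>m\<in>M. \<exists>w. u = m + w}
     (poly_ring V :: (('v \<Rightarrow>\<^sub>0 nat) \<Rightarrow>\<^sub>0 'k::comm_ring_1) ring)"
    (is "ideal ?J ?S")
proof -
  interpret S: cring ?S
    by (rule cring_poly_ring)
  have neg: "\<ominus>\<^bsub>?S\<^esub> p = - p" if "p \<in> carrier ?S" for p
    by (rule S.minus_equality) (use that in \<open>auto simp: poly_ring_def\<close>)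
  have mult: "q * p \<in> ?J" if "p \<in> ?J" "q \<in> carrier ?S" for p q
  proof -
    have "q * p \<in> carrier ?S"
      using S.m_closed[of q p] that by (simp add: poly_ring_def)
    moreover have "\<exists>m\<in>M. \<exists>w. u = m + w" if u: "u \<in> Poly_Mapping.keys (q * p)" for u
    proof -
      obtain s t where "u = s + t" "t \<in> Poly_Mapping.keys p"
        using u keys_mult[of q p] by blast
      moreover from this obtain m w where "m \<in> M" "t = m + w"
        using \<open>p \<in> ?J\<close> by auto
      ultimately have "u = m + (s + w)"
        by (simp add: add_ac)
      with \<open>m \<in> M\<close> show ?thesis by blast
    qed
    ultimately show ?thesis by blast
  qed
  show ?thesis
  proof (rule idealI)
    show "ring ?S" by (rule S.ring_axioms)
    show "subgroup ?J (add_monoid ?S)"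
    proof (rule S.add.subgroupI)
      show "?J \<noteq> {}"
        using S.zero_closed by (auto simp: poly_ring_def intro: exI[of _ 0])
      show "\<ominus>\<^bsub>?S\<^esub> p \<in> ?J" if "p \<in> ?J" for p
        using that neg S.a_inv_closed[of p] by (simp add: poly_ring_def)
      show "p \<oplus>\<^bsub>?S\<^esub> q \<in> ?J" if "p \<in> ?J" "q \<in> ?J" for p q
        using that S.a_closed[of p q] keys_add[of p q] by (fastforce simp: poly_ring_def)
    qed auto
    show "q \<otimes>\<^bsub>?S\<^esub> p \<in> ?J" if "p \<in> ?J" "q \<in> carrier ?S" for p q
      using mult[OF that] by (simp add: poly_ring_def)
    show "p \<otimes>\<^bsub>?S\<^esub> q \<in> ?J" if "p \<in> ?J" "q \<in> carrier ?S" for p q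
      using mult[OF that] by (simp add: poly_ring_def mult.commute)
  qed
qed

lemma mono_poly_in_carrier: "u \<in> monomials V \<Longrightarrow> mono_poly u \<in> carrier (poly_ring V)"
  by (auto simp: mono_poly_def poly_ring_def)

lemma mono_poly_add: "mono_poly (u + w) = mono_poly u * mono_poly w"
  by (simp add: mono_poly_def mult_single)

lemma mono_poly_in_genideal_iff:
  assumes "M \<subseteq> monomials V"
  shows "(mono_poly u :: ('v \<Rightarrow>\<^sub>0 nat) \<Rightarrow>\<^sub>0 'k::comm_ring_1)
      \<in> genideal (poly_ring V) (mono_poly ` M) \<longleftrightarrow>
    u \<in> monomials V \<and> (\<exists>m\<in>M. \<exists>w. u = m + w)"
    (is "?p \<in> genideal ?S ?M \<longleftrightarrow> ?R")
proof
  let ?J = "{p \<in> carrier ?S. \<forall>u\<in>Poly_Mapping.keys p. \<exists>m\<in>M. \<exists>w. u = m + w}"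
  have "?M \<subseteq> ?J"
  proof
    fix p assume "p \<in> ?M"
    then obtain m where m: "m \<in> M" "p = mono_poly m" by blast
    then have "p \<in> carrier ?S"
      using assms mono_poly_in_carrier by blast
    moreover have "u = m + 0" if "u \<in> Poly_Mapping.keys p" for u
      using that m by (auto simp: mono_poly_def split: if_splits)
    ultimately show "p \<in> ?J"
      using m by blast
  qed
  moreover assume "?p \<in> genideal ?S ?M"
  ultimately have "?p \<in> ?J"
    using ideal_multiples[of V M] by (fastforce simp: genideal_def)
  then show ?R
    by (auto simp: mono_poly_def poly_ring_def)
next
  interpret S: cring ?S
    by (rule cring_poly_ring)
  assume R: ?R
  then obtain m w where m: "m \<in> M" "u = m + w" by blast
  then have "w \<in> monomials V"
    using R by (auto simp: monomials_add_iff)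
  have sub: "?M \<subseteq> carrier ?S"
    using assms mono_poly_in_carrier by blast
  then interpret ideal "genideal ?S ?M" ?S
    by (rule S.genideal_ideal)
  have "mono_poly m \<in> genideal ?S ?M"
    using S.genideal_self[OF sub] m by blast
  then have "mono_poly m \<otimes>\<^bsub>?S\<^esub> mono_poly w \<in> genideal ?S ?M"
    using mono_poly_in_carrier[OF \<open>w \<in> monomials V\<close>] by (rule I_r_closed)
  then show "?p \<in> genideal ?S ?M"
    using m by (simp add: mono_poly_add poly_ring_def)
qed

text \<open>
  An element of \<open>M\<close> is divisible by some element of another generating set \<open>N\<close>, which in turn is
  divisible by some element of \<open>M\<close>. If \<open>M\<close> is an antichain for divisibility, then all three
  coincide, so that \<open>M\<close> is the least set of monomials generating the ideal.
\<close>

lemma antichain_subset_generators: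
  fixes L :: "(('v \<Rightarrow>\<^sub>0 nat) \<Rightarrow>\<^sub>0 'k::comm_ring_1) set"
  assumes M: "generates V M L" and N: "generates V N L"
    and antichain: "\<And>u w. u \<in> M \<Longrightarrow> u + w \<in> M \<Longrightarrow> w = 0"
  shows "M \<subseteq> N"
proof
  have mem_iff: "(mono_poly u :: _ \<Rightarrow>\<^sub>0 'k) \<in> L \<longleftrightarrow>
      u \<in> monomials V \<and> (\<exists>m\<in>A. \<exists>w. u = m + w)" if "generates V A L" for A u
    using that mono_poly_in_genideal_iff[of A V u] unfolding generates_def by blast
  fix u assume "u \<in> M"
  moreover from this have "u \<in> monomials V"
    using M by (auto simp: generates_def)
  moreover have "u = u + 0" by simp
  ultimately have "(mono_poly u :: _ \<Rightarrow>\<^sub>0 'k) \<in> L"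
    unfolding mem_iff[OF M] by blast
  then obtain n w where n: "n \<in> N" "u = n + w"
    unfolding mem_iff[OF N] by blast
  moreover from this have "n \<in> monomials V"
    using N by (auto simp: generates_def)
  moreover have "n = n + 0" by simp
  ultimately have "(mono_poly n :: _ \<Rightarrow>\<^sub>0 'k) \<in> L"
    unfolding mem_iff[OF N] by blast
  then obtain m w' where m: "m \<in> M" "n = m + w'"
    unfolding mem_iff[OF M] by blast
  then have "w' + w = 0"
    using antichain[of m "w' + w"] n \<open>u \<in> M\<close> by (simp add: add_ac)
  then have "Poly_Mapping.lookup w z = 0" for z
    by (metis add_is_0 lookup_add lookup_zero)
  then have "w = 0"
    by (intro poly_mapping_eqI) simp
  with n show "u \<in> N" by simp
qed

lemma min_gens_antichain:
  assumes M: "generates V M L"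
    and antichain: "\<And>u w. u \<in> M \<Longrightarrow> u + w \<in> M \<Longrightarrow> w = 0"
  shows "min_gens V L = M"
proof -
  have least: "M \<subseteq> N" if "generates V N L" for N
    using M that antichain by (rule antichain_subset_generators)
  show ?thesis
    unfolding min_gens_def using M least by (intro the_equality) blast+
qed


section \<open>Edge ideals\<close>

lemma mono_deg_add: "mono_deg (u + w) = mono_deg u + mono_deg w"
proof -
  have *: "mono_deg v = (\<Sum>z\<in>A. Poly_Mapping.lookup v z)"
    if "finite A" "Poly_Mapping.keys v \<subseteq> A" for v :: "'a \<Rightarrow>\<^sub>0 nat" and A
    unfolding mono_deg_def using that
    by (intro sum.mono_neutral_left) (auto simp: in_keys_iff)
  let ?A = "Poly_Mapping.keys u \<union> Poly_Mapping.keys w"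
  show ?thesis
    using *[of ?A u] *[of ?A w] *[of ?A "u + w"] keys_add[of u w]
    by (simp add: lookup_add sum.distrib)
qed

lemma mono_deg_eq_0_iff: "mono_deg w = 0 \<longleftrightarrow> w = 0"
proof -
  have "mono_deg w = 0 \<longleftrightarrow> Poly_Mapping.keys w = {}"
    unfolding mono_deg_def
    by (subst sum_eq_0_iff[OF finite_keys]) (metis all_not_in_conv in_keys_iff)
  then show ?thesis
    by (simp only: keys_eq_empty)
qed

lemma mono_deg_edge: "mono_deg (var_exp x + var_exp y) = 2"
  by (simp add: mono_deg_add) (simp add: mono_deg_def)

lemma keys_edge: "Poly_Mapping.keys (var_exp x + var_exp y) = {x, y}"
  by (auto simp: in_keys_iff lookup_add lookup_single when_def split: if_splits)

lemma generates_edge_ideal: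
  fixes G :: "'v pair_pre_digraph"
  assumes "pair_graph G"
  shows "generates (pverts G) {var_exp x + var_exp y | x y. (x, y) \<in> parcs G}
    (edge_ideal G :: (('v \<Rightarrow>\<^sub>0 nat) \<Rightarrow>\<^sub>0 'k::comm_ring_1) set)"
proof -
  interpret pair_graph G by fact
  have "{var_exp x + var_exp y | x y. (x, y) \<in> parcs G} \<subseteq> monomials (pverts G)"
    using in_arcsD1 in_arcsD2 by (auto simp: monomials_def keys_edge simp del: One_nat_def)
  moreover have "mono_poly ` {var_exp x + var_exp y | x y. (x, y) \<in> parcs G} =
      {mono_poly (var_exp x + var_exp y) | x y. (x, y) \<in> parcs G}"
    by blast
  then have "mono_poly ` {var_exp x + var_exp y | x y. (x, y) \<in> parcs G} =
      {var_poly x * var_poly y :: _ \<Rightarrow>\<^sub>0 'k | x y. (x, y) \<in> parcs G}"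
    by (simp only: var_poly_def mono_poly_add)
  ultimately show ?thesis
    by (simp only: generates_def edge_ideal_def simp_thms)
qed

text \<open>All edge monomials have degree two, so none of them properly divides another.\<close>

lemma min_gens_edge_ideal:
  fixes G :: "'v pair_pre_digraph"
  assumes "pair_graph G"
  shows "min_gens (pverts G) (edge_ideal G :: (('v \<Rightarrow>\<^sub>0 nat) \<Rightarrow>\<^sub>0 'k::comm_ring_1) set) =
    {var_exp x + var_exp y | x y. (x, y) \<in> parcs G}" (is "_ = ?M")
proof (rule min_gens_antichain)
  show "generates (pverts G) ?M (edge_ideal G :: (('v \<Rightarrow>\<^sub>0 nat) \<Rightarrow>\<^sub>0 'k) set)"
    by (rule generates_edge_ideal) fact
  fix u w assume "u \<in> ?M" "u + w \<in> ?M"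
  then have "mono_deg u = 2" "mono_deg (u + w) = 2"
    by (auto simp: mono_deg_edge simp del: One_nat_def)
  then show "w = 0"
    by (simp add: mono_deg_add mono_deg_eq_0_iff)
qed

lemma matroidal_edge_ideal:
  fixes G :: "'v pair_pre_digraph"
  assumes G: "pair_graph G"
    and "matroid (pverts G) indep" and "bases indep = {{x, y} | x y. (x, y) \<in> parcs G}"
  shows "matroidal (pverts G) (edge_ideal G :: (('v \<Rightarrow>\<^sub>0 nat) \<Rightarrow>\<^sub>0 'k::comm_ring_1) set)"
proof -
  interpret pair_graph G by fact
  let ?V = "pverts G" and ?L = "edge_ideal G :: (('v \<Rightarrow>\<^sub>0 nat) \<Rightarrow>\<^sub>0 'k) set"
  note gens = min_gens_edge_ideal[OF G, where 'k = 'k]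
  have "monomial_ideal ?V ?L"
    unfolding monomial_ideal_def using generates_edge_ideal[OF G] by blast
  moreover have "squarefree_ideal ?V ?L"
    unfolding squarefree_ideal_def
  proof (intro ballI allI)
    fix u z assume "u \<in> min_gens ?V ?L"
    then obtain x y where "(x, y) \<in> parcs G" "u = var_exp x + var_exp y"
      unfolding gens by blast
    moreover from this have "x \<noteq> y"
      using no_loops[of "(x, y)"] by simp
    ultimately show "Poly_Mapping.lookup u z \<le> 1"
      by (auto simp: lookup_add lookup_single when_def)
  qed
  moreover have "generated_in_single_degree ?V ?L"
    unfolding generated_in_single_degree_def gens
    by (intro exI[of _ 2] ballI, elim CollectE exE conjE) (simp only: mono_deg_edge)
  moreover have "Poly_Mapping.keys ` min_gens ?V ?L = bases indep"
  proof -
    have "Poly_Mapping.keys ` min_gens ?V ?L =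
        {Poly_Mapping.keys (var_exp x + var_exp y) | x y. (x, y) \<in> parcs G}"
      unfolding gens by blast
    then show ?thesis
      by (simp only: keys_edge assms(3))
  qed
  ultimately show ?thesis
    unfolding matroidal_def using assms(2) by blast
qed


section \<open>Matroidal ideals are polymatroidal\<close>

lemma (in matroid) finite_indep: "indep X \<Longrightarrow> finite X"
  using indep_subset_ground finite_ground finite_subset by blast

lemma (in matroid) card_indep_le_basis:
  assumes "B \<in> bases indep" "indep X"
  shows "card X \<le> card B"
proof (rule ccontr)
  assume "\<not> card X \<le> card B"
  then obtain y where "y \<in> X - B" "indep (insert y B)"
    using assms augment[of B X] by (auto simp: bases_def)
  then show False
    using assms by (auto simp: bases_def)
qed

lemma (in matroid) basis_exchange:
  assumes B: "B \<in> bases indep" and C: "C \<in> bases indep" and x: "x \<in> B - C"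
  shows "\<exists>y\<in>C - B. insert y (B - {x}) \<in> bases indep"
proof -
  have ind: "indep B" "indep C"
    using B C by (auto simp: bases_def)
  then have fin: "finite B"
    by (auto dest: finite_indep)
  have "card (B - {x}) < card B"
    using fin x by (intro psubset_card_mono) auto
  also have "card B \<le> card C"
    using card_indep_le_basis C ind by blast
  finally obtain y where y: "y \<in> C - (B - {x})" "indep (insert y (B - {x}))"
    using augment[of "B - {x}" C] indep_subset[of B] ind by blast
  then have "y \<in> C - B"
    using x by auto
  moreover have "card (insert y (B - {x})) = card B"
    using fin x \<open>y \<in> C - B\<close> by (metis Diff_iff card_Suc_Diff1 card_insert_disjoint finite_Diff)
  \<comment> \<open>An independent set with as many elements as a basis is maximal.\<close>
  then have "X = insert y (B - {x})" if "indep X" "insert y (B - {x}) \<subseteq> X" for X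
    using card_seteq[OF finite_indep[OF that(1)] that(2)] card_indep_le_basis[OF B that(1)]
    by simp
  then have "insert y (B - {x}) \<in> bases indep"
    unfolding bases_def using y by blast
  ultimately show ?thesis by blast
qed

text \<open>
  Square-free monomials are determined by their supports. Hence an exponent that is larger in \<open>u\<close>
  than in \<open>v\<close> is an element of the support of \<open>u\<close> only, and the quotient
  \<open>z\<^sub>j u / z\<^sub>i\<close> is the square-free monomial whose support is the exchanged basis.
\<close>

lemma matroidal_imp_polymatroidal:
  fixes L :: "(('v \<Rightarrow>\<^sub>0 nat) \<Rightarrow>\<^sub>0 'k::comm_ring_1) set"
  assumes "matroidal V L"
  shows "polymatroidal V L"
proof -
  obtain indep where "matroid V indep" and
      bases: "Poly_Mapping.keys ` min_gens V L = bases indep"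
    using assms by (auto simp: matroidal_def)
  interpret matroid V indep by fact
  have lookup: "Poly_Mapping.lookup u z = (if z \<in> Poly_Mapping.keys u then 1 else 0)"
    if "u \<in> min_gens V L" for u z
  proof -
    have "Poly_Mapping.lookup u z \<le> 1"
      using assms that by (auto simp: matroidal_def squarefree_ideal_def)
    then show ?thesis
      by (cases "Poly_Mapping.lookup u z") (auto simp: in_keys_iff)
  qed
  have "\<exists>j\<in>V. Poly_Mapping.lookup u j < Poly_Mapping.lookup v j \<and>
      var_exp j + u - var_exp i \<in> min_gens V L"
    if uv: "u \<in> min_gens V L" "v \<in> min_gens V L"
      and "Poly_Mapping.lookup u i > Poly_Mapping.lookup v i" for u v i
  proof -
    have i: "i \<in> Poly_Mapping.keys u - Poly_Mapping.keys v"
      using that by (auto simp: lookup split: if_splits)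
    then obtain j where j: "j \<in> Poly_Mapping.keys v - Poly_Mapping.keys u"
        and "insert j (Poly_Mapping.keys u - {i}) \<in> bases indep"
      using basis_exchange[of "Poly_Mapping.keys u" "Poly_Mapping.keys v" i] uv bases by blast
    then obtain w where w: "w \<in> min_gens V L"
        "Poly_Mapping.keys w = insert j (Poly_Mapping.keys u - {i})"
      using bases by (metis imageE)
    have "var_exp j + u - var_exp i = w"
    proof (rule poly_mapping_eqI)
      fix z
      show "Poly_Mapping.lookup (var_exp j + u - var_exp i) z = Poly_Mapping.lookup w z"
        unfolding lookup_minus lookup_add lookup[OF w(1)] lookup[OF uv(1)] w(2)
        using i j by (auto simp: lookup_single when_def)
    qed
    moreover have "Poly_Mapping.keys v \<in> bases indep"
      using uv bases by blast
    then have "Poly_Mapping.keys v \<subseteq> V"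
      using indep_subset_ground by (simp add: bases_def)
    ultimately show ?thesis
      using j w uv by (intro bexI[of _ j]) (auto simp: lookup)
  qed
  then show ?thesis
    using assms by (auto simp: polymatroidal_def matroidal_def)
qed


section \<open>The matroid of the prime ideal graph\<close>

text \<open>
  To enlarge \<open>X\<close> by an element of a bigger independent set \<open>Y\<close>, either some element of \<open>Y - X\<close> lies
  in \<open>A\<close>, and adding it does not affect the part outside \<open>A\<close>; or \<open>Y \<inter> A \<subseteq> X\<close>, and then
  counting shows that \<open>X\<close> has no element outside \<open>A\<close> while \<open>Y\<close> has one.
\<close>

lemma matroid_at_most_one_outside:
  assumes "finite V"
  shows "matroid V (\<lambda>X. X \<subseteq> V \<and> card X \<le> 2 \<and> card (X - A) \<le> 1)"
proof unfold_locales
  fix X Y :: "'a set"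
  assume X: "X \<subseteq> V \<and> card X \<le> 2 \<and> card (X - A) \<le> 1" and "Y \<subseteq> X"
  moreover have "finite X"
    using X assms finite_subset by blast
  ultimately have "card Y \<le> card X" "card (Y - A) \<le> card (X - A)"
    by (auto intro!: card_mono)
  with X \<open>Y \<subseteq> X\<close> show "Y \<subseteq> V \<and> card Y \<le> 2 \<and> card (Y - A) \<le> 1"
    by auto
next
  fix X Y :: "'a set"
  assume X: "X \<subseteq> V \<and> card X \<le> 2 \<and> card (X - A) \<le> 1"
    and Y: "Y \<subseteq> V \<and> card Y \<le> 2 \<and> card (Y - A) \<le> 1" and less: "card X < card Y"
  have fin: "finite X" "finite Y"
    using X Y assms finite_subset by blast+
  have insert: "insert y X \<subseteq> V \<and> card (insert y X) \<le> 2" if "y \<in> Y" for y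
    using that X Y less fin by (auto simp: card_insert_if)
  show "\<exists>y\<in>Y - X. insert y X \<subseteq> V \<and> card (insert y X) \<le> 2 \<and> card (insert y X - A) \<le> 1"
  proof (cases "(Y - X) \<inter> A = {}")
    case False
    then obtain y where "y \<in> Y - X" "y \<in> A" by blast
    then show ?thesis
      using X insert by (intro bexI[of _ y]) auto
  next
    case True
    have "card (Y \<inter> A) \<le> card (X \<inter> A)"
      using True fin by (intro card_mono) auto
    then have "card (X - A) < card (Y - A)"
      using less card_Int_Diff[OF fin(1), of A] card_Int_Diff[OF fin(2), of A] by linarith
    then have "card (X - A) = 0" and "card (Y - A) \<noteq> 0"
      using Y by linarith+
    then have "X - A = {}" and "Y - A \<noteq> {}"
      using fin by simp_all
    then obtain y where y: "y \<in> Y - A" by blast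
    have "insert y X - A = {y}"
      using \<open>X - A = {}\<close> y by auto
    then show ?thesis
      using \<open>X - A = {}\<close> y insert by (intro bexI[of _ y]) auto
  qed
qed (use assms in auto)

text \<open>
  The hypotheses provide the independent pair \<open>{a, b}\<close>; without it the bases could be smaller than
  an edge.
\<close>

lemma bases_at_most_one_outside:
  assumes fin: "finite V" and a: "a \<in> V" "a \<in> A" and b: "b \<in> V" "b \<notin> A"
  shows "bases (\<lambda>X. X \<subseteq> V \<and> card X \<le> 2 \<and> card (X - A) \<le> 1) =
    {{x, y} | x y. x \<in> V \<and> y \<in> V \<and> x \<noteq> y \<and> (x \<in> A \<or> y \<in> A)}"
    (is "bases ?indep = ?E")
proof (intro equalityI subsetI)
  interpret matroid V ?indep
    by (rule matroid_at_most_one_outside) fact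
  fix B assume B: "B \<in> bases ?indep"
  have "card {a, b} = 2" "?indep {a, b}"
    using a b by (auto simp: card_insert_if insert_Diff_if)
  then have "2 \<le> card B"
    using card_indep_le_basis[OF B, of "{a, b}"] by simp
  moreover have "?indep B"
    using B by (simp add: bases_def)
  ultimately have "card B = 2" "B \<subseteq> V" "card (B - A) \<le> 1" by auto
  then obtain x y where xy: "B = {x, y}" "x \<noteq> y"
    by (auto simp: card_2_iff)
  have "x \<in> A \<or> y \<in> A"
  proof (rule ccontr)
    assume "\<not> (x \<in> A \<or> y \<in> A)"
    then have "B - A = B"
      using xy by blast
    then show False
      using \<open>card B = 2\<close> \<open>card (B - A) \<le> 1\<close> by simp
  qed
  with xy \<open>B \<subseteq> V\<close> show "B \<in> ?E" by blast
next
  fix B assume "B \<in> ?E"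
  then obtain x y where xy: "B = {x, y}" "x \<in> V" "y \<in> V" "x \<noteq> y" "x \<in> A \<or> y \<in> A" by blast
  then have "?indep B"
    by (auto simp: card_insert_if insert_Diff_if)
  moreover have "X = B" if "?indep X" "B \<subseteq> X" for X
  proof -
    have "finite X"
      using that fin finite_subset by blast
    then show ?thesis
      using card_seteq[of X B] that xy by simp
  qed
  ultimately show "B \<in> bases ?indep"
    unfolding bases_def by blast
qed

theorem proposition6p2:
  fixes R :: "('a, 'm) ring_scheme" and P :: "'a set"
    and I :: "(('a \<Rightarrow>\<^sub>0 nat) \<Rightarrow>\<^sub>0 'k::field) set"
  assumes "cring R" and "finite (carrier R)"
    and "primeideal P R"
    and "card P \<ge> 2"
    and "I = edge_ideal (prime_ideal_graph R P)"
  shows "matroidal (carrier R - {\<zero>\<^bsub>R\<^esub>}) I \<and> polymatroidal (carrier R - {\<zero>\<^bsub>R\<^esub>}) I"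
proof -
  interpret primeideal P R by fact
  let ?V = "carrier R - {\<zero>\<^bsub>R\<^esub>}" and ?G = "prime_ideal_graph R P"
  have verts: "pverts ?G = ?V"
    by (simp add: prime_ideal_graph_def)
  have "\<one>\<^bsub>R\<^esub> \<notin> P"
    using one_imp_carrier I_notcarr by blast
  then have one: "\<one>\<^bsub>R\<^esub> \<in> ?V" "\<one>\<^bsub>R\<^esub> \<notin> P"
    using additive_subgroup.zero_closed[OF is_additive_subgroup] by auto
  obtain a where a: "a \<in> ?V" "a \<in> P"
  proof -
    have "\<not> P \<subseteq> {\<zero>\<^bsub>R\<^esub>}"
      using assms(4) card_mono[of "{\<zero>\<^bsub>R\<^esub>}" P] by auto
    then show ?thesis
      using that Icarr by blast
  qed
  have "x \<otimes>\<^bsub>R\<^esub> y \<in> P \<longleftrightarrow> x \<in> P \<or> y \<in> P" if "x \<in> carrier R" "y \<in> carrier R" for x y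
    using that I_prime[of x y] I_l_closed[of y x] I_r_closed[of x y] by auto
  then have arcs: "(x, y) \<in> parcs ?G \<longleftrightarrow>
      x \<in> ?V \<and> y \<in> ?V \<and> x \<noteq> y \<and> (x \<in> P \<or> y \<in> P)" for x y
    by (auto simp: prime_ideal_graph_def)
  have fin: "finite ?V"
    using assms(2) by simp
  have "bases (\<lambda>X. X \<subseteq> ?V \<and> card X \<le> 2 \<and> card (X - P) \<le> 1) =
      {{x, y} | x y. (x, y) \<in> parcs ?G}"
    by (simp only: bases_at_most_one_outside[OF fin a one] arcs)
  then have "matroidal ?V I"
    unfolding assms(5) verts[symmetric]
    by (rule matroidal_edge_ideal[OF pair_graph_prime_ideal_graph[OF assms(1,2)]
        matroid_at_most_one_outside[OF fin[folded verts]]])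
  then show ?thesis
    using matroidal_imp_polymatroidal by blast
qed

end
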